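(* Let $D$ be a bounded convex domain in $\mathbb{C}^n$ and let $f:D\to D$ be a holomorphic map. If $\mathrm{Fix}(f)$ is discrete and non-empty, then it consists of exactly one point.
   Context: $\mathrm{Fix}(f)=\{x\in D : f(x)=x\}$ denotes the fixed point set of $f$. *)

theory Defs
  imports "HOL-Analysis.Analysis"
begin

(* The library's holomorphic_on covers only functions of one complex variable.  For several
   variables: the real Frechet derivative exists at every point of the set and is C-linear,
   where *s is the scaling of vectors by complex scalars.  Intended for open sets. *)
definition holomorphic_map_on :: "(complex ^ 'n \<Rightarrow> complex ^ 'm) \<Rightarrow> (complex ^ 'n) set \<Rightarrow> bool"
    (infixl \<open>holomorphic'_map'_on\<close> 50)
  where "f holomorphic_map_on S \<longleftrightarrow>
    (\<forall>z\<in>S. \<exists>f'. (f has_derivative f') (at z within S) \<and> (\<forall>c v. f' (c *s v) = c *s f' v))"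

definition Fix_on :: "'a set \<Rightarrow> ('a \<Rightarrow> 'a) \<Rightarrow> 'a set"
  where "Fix_on D f = {x \<in> D. f x = x}"

end

(* Let p and q be distinct fixed points and consider the holomorphic discs \<phi> into D with \<phi>(0) = p
   and \<phi>(r) = q, where r > 0 is close to the infimum of the admissible parameters.  Composition
   with f preserves this set of discs, and so do convex combinations; hence for small s > 0 the
   values \<phi>(s) form a convex f-invariant set, whose closure stays in D by Harnack's inequality.
   Brouwer's theorem yields a fixed point m in this closure, and m is O(s)-close to p since D is
   bounded.  If p is isolated then m = p, so some \<phi>(s) is arbitrarily close to p; moving s to 0
   by a disc automorphism and correcting linearly gives a disc from p to q with a parameter
   below the infimum. *)

theory Submission
  imports Defs "HOL-Complex_Analysis.Riemann_Mapping"
begin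

lemma norm_vector_scalar_mult:
  fixes v :: "'a::real_normed_field ^ 'n"
  shows "norm (c *s v) = norm c * norm v"
  by (simp add: norm_vec_def norm_mult L2_set_right_distrib)

section \<open>Holomorphic discs and the operations preserving them\<close>

text \<open>Holomorphy is required coordinate by coordinate, so that one-variable results such as
  the Schwarz lemma apply directly.\<close>

definition holomorphic_disc :: "(complex ^ 'n) set \<Rightarrow> (complex \<Rightarrow> complex ^ 'n) \<Rightarrow> bool"
  where "holomorphic_disc D \<phi> \<longleftrightarrow>
    (\<forall>i. (\<lambda>z. \<phi> z $ i) holomorphic_on ball 0 1) \<and> \<phi> \<in> ball 0 1 \<rightarrow> D"

lemma holomorphic_discI:
  assumes "\<And>i. (\<lambda>z. \<phi> z $ i) holomorphic_on ball 0 1"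
    and "\<And>z. norm z < 1 \<Longrightarrow> \<phi> z \<in> D"
  shows "holomorphic_disc D \<phi>"
  using assms by (auto simp: holomorphic_disc_def)

lemma holomorphic_discD:
  assumes "holomorphic_disc D \<phi>"
  shows "(\<lambda>z. \<phi> z $ i) holomorphic_on ball 0 1"
    and "norm z < 1 \<Longrightarrow> \<phi> z \<in> D"
  using assms by (auto simp: holomorphic_disc_def)

lemma holomorphic_disc_reparam:
  assumes "holomorphic_disc D \<phi>" and "g holomorphic_on ball 0 1"
    and "\<And>z. norm z < 1 \<Longrightarrow> norm (g z) < 1"
  shows "holomorphic_disc D (\<lambda>z. \<phi> (g z))"
proof (rule holomorphic_discI)
  fix i
  have "(\<lambda>z. \<phi> z $ i) \<circ> g holomorphic_on ball 0 1"
    by (rule holomorphic_on_compose_gen[OF assms(2) holomorphic_discD(1)[OF assms(1)]])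
      (use assms(3) in auto)
  then show "(\<lambda>z. \<phi> (g z) $ i) holomorphic_on ball 0 1"
    by (simp add: o_def)
qed (use assms holomorphic_discD(2) in blast)

lemma holomorphic_disc_image:
  fixes f :: "complex ^ 'n \<Rightarrow> complex ^ 'm"
  assumes "open D" and "f holomorphic_map_on D" and "f \<in> D \<rightarrow> E" and "holomorphic_disc D \<phi>"
  shows "holomorphic_disc E (\<lambda>z. f (\<phi> z))"
proof (rule holomorphic_discI)
  fix i
  have "(\<lambda>z. f (\<phi> z) $ i) field_differentiable at z" if z: "norm z < 1" for z
  proof -
    have "\<exists>d. ((\<lambda>z. \<phi> z $ j) has_field_derivative d) (at z)" for j
      using holomorphic_discD(1)[OF assms(4), of j] z
      by (meson field_differentiable_def holomorphic_on_imp_differentiable_at mem_ball_0 open_ball)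
    then obtain d where d: "\<And>j. ((\<lambda>z. \<phi> z $ j) has_field_derivative d j) (at z)"
      by metis
    have "(\<phi> has_derivative (\<lambda>h. \<chi> j. d j * h)) (at z)"
      using d unfolding has_field_derivative_def
      by (subst has_derivative_componentwise_within)
        (auto simp: Basis_vec_def inner_axis intro!: has_derivative_inner_left)
    moreover obtain f' where f': "(f has_derivative f') (at (\<phi> z))"
        "\<And>c v. f' (c *s v) = c *s f' v"
      using assms(1,2) holomorphic_discD(2)[OF assms(4) z] at_within_open
      by (metis holomorphic_map_on_def)
    ultimately have "((\<lambda>z. f (\<phi> z)) has_derivative (\<lambda>h. f' (\<chi> j. d j * h))) (at z)"
      using has_derivative_compose by blast
    \<comment> \<open>Complex linearity of \<open>f'\<close> is what turns the real derivative of
      the composite into multiplication by a fixed complex vector.\<close>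
    moreover have "f' (\<chi> j. d j * h) = h *s f' (\<chi> j. d j)" for h
    proof -
      have "(\<chi> j. d j * h) = h *s (\<chi> j. d j)"
        by (simp add: vec_eq_iff mult.commute)
      then show ?thesis by (simp add: f'(2))
    qed
    ultimately have "((\<lambda>z. f (\<phi> z) $ i) has_derivative (\<lambda>h. (h *s f' (\<chi> j. d j)) $ i)) (at z)"
      using bounded_linear.has_derivative[OF bounded_linear_vec_nth] by fastforce
    then have "((\<lambda>z. f (\<phi> z) $ i) has_field_derivative (f' (\<chi> j. d j) $ i)) (at z)"
      by (simp add: has_field_derivative_def mult_commute_abs)
    then show ?thesis
      using field_differentiable_def by blast
  qed
  then show "(\<lambda>z. f (\<phi> z) $ i) holomorphic_on ball 0 1"
    by (simp add: holomorphic_on_def field_differentiable_at_within)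
qed (use assms holomorphic_discD(2) in blast)

lemma holomorphic_disc_convex_combination:
  assumes "convex D" "holomorphic_disc D \<phi>" "holomorphic_disc D \<psi>"
    and "0 \<le> u" "0 \<le> v" "u + v = 1"
  shows "holomorphic_disc D (\<lambda>z. u *\<^sub>R \<phi> z + v *\<^sub>R \<psi> z)"
proof (rule holomorphic_discI)
  fix i
  show "(\<lambda>z. (u *\<^sub>R \<phi> z + v *\<^sub>R \<psi> z) $ i) holomorphic_on ball 0 1"
    using assms(2,3)[THEN holomorphic_discD(1)]
    by (auto simp: scaleR_conv_of_real intro!: holomorphic_intros)
next
  fix z :: complex assume "norm z < 1"
  then show "u *\<^sub>R \<phi> z + v *\<^sub>R \<psi> z \<in> D"
    using assms by (intro convexD) (auto dest: holomorphic_discD(2))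
qed

section \<open>Harnack and Schwarz estimates for discs\<close>

text \<open>The Cayley transform \<open>G\<close> of \<open>F\<close> sends the right half-plane to
  the unit disc and \<open>F 0\<close> to 0; the Schwarz lemma for \<open>G\<close>, rewritten in
  terms of real parts, is the claim.\<close>

lemma Harnack_lower_bound:
  assumes F: "F holomorphic_on ball 0 1" and pos: "\<And>z. norm z < 1 \<Longrightarrow> 0 < Re (F z)"
    and z: "norm z \<le> t" "t < 1"
  shows "(1 - t) / (1 + t) * Re (F 0) \<le> Re (F z)"
proof -
  define G where "G = (\<lambda>z. (F z - F 0) / (F z + cnj (F 0)))"
  have norm_diff: "(norm (F w - F 0))\<^sup>2 = (Re (F w) - Re (F 0))\<^sup>2 + (Im (F w) - Im (F 0))\<^sup>2"
    and norm_sum: "(norm (F w + cnj (F 0)))\<^sup>2 = (Re (F w) + Re (F 0))\<^sup>2 + (Im (F w) - Im (F 0))\<^sup>2" for w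
    by (simp_all add: cmod_power2)
  have nz: "F w + cnj (F 0) \<noteq> 0" if "norm w < 1" for w
    using pos[OF that] pos[of 0] by (auto simp: complex_eq_iff)
  have "norm (G w) < 1" if w: "norm w < 1" for w
  proof -
    \<comment> \<open>The two squares differ by 4 \<open>Re (F w)\<close> \<open>Re (F 0)\<close>,
      which is positive.\<close>
    have "(norm (F w - F 0))\<^sup>2 < (norm (F w + cnj (F 0)))\<^sup>2"
      unfolding norm_diff norm_sum using mult_pos_pos[OF pos[OF w] pos[of 0]]
      by (simp add: power2_eq_square algebra_simps)
    then have "norm (F w - F 0) < norm (F w + cnj (F 0))"
      by (rule power_less_imp_less_base) simp
    then show ?thesis
      using nz[OF w] by (simp add: G_def norm_divide)
  qed
  moreover have "G holomorphic_on ball 0 1"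
    unfolding G_def using nz by (intro holomorphic_intros F) auto
  moreover have "G 0 = 0"
    by (simp add: G_def)
  ultimately have "norm (G z) \<le> norm z"
    using z by (intro Schwarz_Lemma(1)) auto
  then have "norm (F z - F 0) \<le> t * norm (F z + cnj (F 0))"
    using nz[of z] z by (auto simp: G_def norm_divide divide_le_eq split: if_splits
      intro: order_trans[OF _ mult_right_mono])
  then have "(norm (F z - F 0))\<^sup>2 \<le> t\<^sup>2 * (norm (F z + cnj (F 0)))\<^sup>2"
    by (metis norm_ge_zero power_mono power_mult_distrib)
  moreover have "0 \<le> t"
    using z norm_ge_zero order_trans by blast
  moreover from this have "t\<^sup>2 \<le> 1"
    using z by (simp add: power_le_one)
  moreover note t = calculation(2,3)
  ultimately have "(Re (F z) - Re (F 0))\<^sup>2 \<le> (t * (Re (F z) + Re (F 0)))\<^sup>2"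
    using mult_right_mono[OF t(2) zero_le_power2[of "Im (F z) - Im (F 0)"]]
    unfolding norm_diff norm_sum by (subst power_mult_distrib) (simp add: distrib_left)
  then have "\<bar>Re (F z) - Re (F 0)\<bar> \<le> \<bar>t * (Re (F z) + Re (F 0))\<bar>"
    by (simp add: abs_le_square_iff)
  also have "\<dots> = t * (Re (F z) + Re (F 0))"
    using t pos[of z] pos[of 0] z by (simp add: abs_of_nonneg)
  finally have "(1 - t) * Re (F 0) \<le> Re (F z) * (1 + t)"
    by (simp add: abs_le_iff algebra_simps)
  then show ?thesis
    using t by (simp add: field_simps)
qed

text \<open>A half-space supporting \<^term>\<open>D\<close> at a point outside it turns the disc into a holomorphic
  function with positive real part, to which Harnack's inequality applies.\<close>

lemma holomorphic_disc_ball_subset: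
  fixes D :: "(complex ^ 'n) set"
  assumes "open D" "convex D" "holomorphic_disc D \<phi>" and d: "0 < d" "ball (\<phi> 0) d \<subseteq> D"
    and z: "norm z \<le> t" "t < 1"
  shows "ball (\<phi> z) ((1 - t) / (1 + t) * d) \<subseteq> D"
proof (rule ccontr)
  assume "\<not> ?thesis"
  then obtain w where w: "w \<notin> D" "dist (\<phi> z) w < (1 - t) / (1 + t) * d"
    by (auto simp: subset_iff)
  have "\<phi> 0 \<in> D"
    using d by auto
  then obtain a b where a: "a \<noteq> 0" and ab: "\<And>x. x \<in> D \<Longrightarrow> a \<bullet> x \<le> b" "b \<le> a \<bullet> w"
    using separating_hyperplane_sets[of D "{w}"] assms(2) w(1) by auto
  \<comment> \<open>A ball in \<open>D\<close> of radius \<open>e\<close> keeps its centre at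
    distance at least \<open>e\<close> from the hyperplane. The ball being open, the proof moves
    from \<open>x\<close> along the normal by \<open>e'\<close> just below \<open>e\<close>; the
    maximum with 0 keeps that point in the ball.\<close>
  have room: "a \<bullet> x + e * norm a \<le> b" if "ball x e \<subseteq> D" "0 < e" for x e
  proof (rule field_le_epsilon)
    fix \<epsilon> :: real assume "0 < \<epsilon>"
    define e' where "e' = max 0 (e - \<epsilon> / norm a)"
    have e': "0 \<le> e'" "e' < e" "e * norm a \<le> e' * norm a + \<epsilon>"
      using \<open>0 < \<epsilon>\<close> \<open>0 < e\<close> a by (auto simp: e'_def max_def field_simps)
    have "x + (e' / norm a) *\<^sub>R a \<in> D"
      using that(1) e' a by (auto simp: subset_iff dist_norm)
    from ab(1)[OF this] have "a \<bullet> x + e' * norm a \<le> b"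
      using a by (simp add: inner_add_right dot_square_norm power2_eq_square)
    then show "a \<bullet> x + e * norm a \<le> b + \<epsilon>"
      using e' by linarith
  qed
  \<comment> \<open>The real inner product is the real part of the Hermitian one, so
    \<open>Re (F z)\<close> is \<open>norm a\<close> times the distance of \<open>\<phi> z\<close>
    from the hyperplane.\<close>
  define F where "F = (\<lambda>z. of_real b - (\<Sum>i\<in>UNIV. cnj (a $ i) * \<phi> z $ i))"
  have ReF: "Re (F z) = b - a \<bullet> \<phi> z" for z
    by (simp add: F_def inner_vec_def inner_complex_def)
  have "F holomorphic_on ball 0 1"
    unfolding F_def by (intro holomorphic_intros holomorphic_discD(1)[OF assms(3)])
  moreover have "0 < Re (F v)" if v: "norm v < 1" for v
  proof -
    obtain e where "0 < e" "ball (\<phi> v) e \<subseteq> D"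
      using openE[OF assms(1) holomorphic_discD(2)[OF assms(3) v]] by blast
    moreover have "0 < e * norm a"
      using \<open>0 < e\<close> a by simp
    ultimately show ?thesis
      using room[of "\<phi> v" e] by (simp add: ReF)
  qed
  ultimately have "(1 - t) / (1 + t) * Re (F 0) \<le> Re (F z)"
    using z by (rule Harnack_lower_bound)
  moreover have "(1 - t) / (1 + t) * (d * norm a) \<le> (1 - t) / (1 + t) * Re (F 0)"
    using room[OF d(2,1)] z norm_ge_zero[of z] 
    by (intro mult_left_mono) (auto simp: ReF simp del: norm_ge_zero)
  moreover have "Re (F z) < (1 - t) / (1 + t) * d * norm a"
  proof -
    have "Re (F z) \<le> a \<bullet> (w - \<phi> z)"
      using ab(2) by (simp add: ReF inner_diff_right)
    also have "\<dots> \<le> norm a * norm (w - \<phi> z)"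
      by (rule norm_cauchy_schwarz)
    also have "\<dots> < norm a * ((1 - t) / (1 + t) * d)"
      using w(2) a by (intro mult_strict_left_mono) (auto simp: dist_norm norm_minus_commute)
    finally show ?thesis
      by (simp add: mult.commute)
  qed
  ultimately show False
    by (simp add: mult.assoc)
qed

text \<open>The Schwarz lemma applies to each coordinate of \<open>\<phi> - \<phi> 0\<close> divided
  by \<open>2 * M\<close>; summing over the coordinates costs the factor
  \<open>CARD('n)\<close>.\<close>

lemma holomorphic_disc_dist_bound:
  fixes D :: "(complex ^ 'n) set"
  assumes "D \<subseteq> ball 0 M" "holomorphic_disc D \<phi>" "norm z < 1"
  shows "dist (\<phi> z) (\<phi> 0) \<le> real CARD('n) * (2 * M) * norm z"
proof -
  have M: "norm (\<phi> w $ i) < M" if "norm w < 1" for w i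
  proof -
    have "norm (\<phi> w $ i) \<le> norm (\<phi> w)"
      by (rule Finite_Cartesian_Product.norm_nth_le)
    also have "\<dots> < M"
      using holomorphic_discD(2)[OF assms(2) that] assms(1) by auto
    finally show ?thesis .
  qed
  have "0 < M"
    using M[of 0] by (metis norm_ge_zero norm_zero order_le_less_trans zero_less_one)
  have "norm (\<phi> z $ i - \<phi> 0 $ i) \<le> 2 * M * norm z" for i
  proof -
    have "norm ((\<lambda>w. (\<phi> w $ i - \<phi> 0 $ i) / of_real (2 * M)) z) \<le> norm z"
    proof (rule Schwarz_Lemma(1))
      fix w :: complex assume "norm w < 1"
      then have "norm (\<phi> w $ i - \<phi> 0 $ i) < 2 * M"
        using M[of w i] M[of 0 i] norm_triangle_ineq4[of "\<phi> w $ i" "\<phi> 0 $ i"] by simp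
      then show "norm ((\<phi> w $ i - \<phi> 0 $ i) / of_real (2 * M)) < 1"
        using \<open>0 < M\<close> by (simp add: norm_divide norm_mult)
    qed (use \<open>0 < M\<close> assms in \<open>auto intro!: holomorphic_intros holomorphic_discD(1)\<close>)
    then show ?thesis
      using \<open>0 < M\<close> by (simp add: norm_divide norm_mult field_simps)
  qed
  then have "(\<Sum>i\<in>UNIV. norm ((\<phi> z - \<phi> 0) $ i)) \<le> (\<Sum>i\<in>(UNIV::'n set). 2 * M * norm z)"
    by (intro sum_mono) simp
  moreover have "norm (\<phi> z - \<phi> 0) \<le> (\<Sum>i\<in>UNIV. norm ((\<phi> z - \<phi> 0) $ i))"
    unfolding norm_vec_def by (rule L2_set_le_sum) simp
  ultimately show ?thesis
    by (simp add: dist_norm algebra_simps)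
qed

section \<open>Construction of discs with prescribed values\<close>

text \<open>The map is (z + s) / (1 + s z). Precomposing a disc with it makes the value at
  \<open>s\<close> the new centre and, for positive \<open>s\<close>, lowers the parameter of the
  value at \<open>r\<close>.\<close>

lemma disc_automorphism:
  fixes s :: real
  assumes "0 \<le> s" "s < 1"
  obtains g where "g holomorphic_on ball 0 1" "\<And>z. norm z < 1 \<Longrightarrow> norm (g z) < 1"
    "g 0 = of_real s" "\<And>r. \<lbrakk>0 \<le> r; r < 1\<rbrakk> \<Longrightarrow> g (of_real ((r - s) / (1 - r * s))) = of_real r"
proof
  let ?g = "Moebius_function 0 (- of_real s)"
  have s: "norm (- of_real s :: complex) < 1"
    using assms by simp
  show "?g holomorphic_on ball 0 1"
    by (rule Moebius_function_holomorphic[OF s])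
  show "norm (?g z) < 1" if "norm z < 1" for z
    by (rule Moebius_function_norm_lt_1[OF s that])
  show "?g 0 = of_real s"
    by (simp add: Moebius_function_of_zero)
  show "?g (of_real ((r - s) / (1 - r * s))) = of_real r" if "0 \<le> r" "r < 1" for r
  proof -
    have "of_real ((r - s) / (1 - r * s)) = Moebius_function 0 (of_real s) (of_real r)"
      by (simp add: Moebius_function_simple mult.commute)
    then show ?thesis
      using Moebius_function_compose[of "- of_real s" "of_real s" "of_real r"] assms that by simp
  qed
qed

text \<open>The complex line through \<open>p\<close> and \<open>q\<close> meets \<open>D\<close> in
  a proper convex open subset of the plane, for which a Riemann map exists; an automorphism and a
  rotation of the unit disc normalise the two parameters.\<close>

lemma holomorphic_disc_through:
  fixes D :: "(complex ^ 'n) set"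
  assumes "open D" "bounded D" "convex D" "p \<in> D" "q \<in> D" "p \<noteq> q"
  obtains r \<phi> where "0 < r" "r < 1" "holomorphic_disc D \<phi>" "\<phi> 0 = p" "\<phi> (of_real r) = q"
proof -
  define L where "L = (\<lambda>z::complex. p + z *s (q - p))"
  define U where "U = L -` D"
  have contL: "continuous_on UNIV L"
    unfolding L_def by (simp add: continuous_on_vec_lambda vector_scalar_mult_def continuous_intros)
  have "open U"
    unfolding U_def using contL assms(1) by (simp add: open_vimage continuous_on_eq_continuous_at)
  moreover have "convex U"
  proof (rule convexI)
    fix x y and u v :: real assume "x \<in> U" "y \<in> U" and uv: "0 \<le> u" "0 \<le> v" "u + v = 1"
    then have "u *\<^sub>R L x + v *\<^sub>R L y \<in> D"
      using assms(3) by (intro convexD) (auto simp: U_def)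
    moreover have "u *\<^sub>R L x + v *\<^sub>R L y = (u + v) *\<^sub>R p + (u *\<^sub>R x + v *\<^sub>R y) *s (q - p)"
      by (simp add: L_def vec_eq_iff algebra_simps scaleR_conv_of_real[where 'a=complex])
    ultimately show "u *\<^sub>R x + v *\<^sub>R y \<in> U"
      using uv(3) by (simp add: U_def L_def)
  qed
  moreover have "U \<noteq> UNIV"
  proof
    assume "U = UNIV"
    obtain M where "0 < M" and M: "D \<subseteq> ball 0 M"
      using bounded_subset_ballD[OF assms(2)] by blast
    \<comment> \<open>Chosen so that \<open>L z\<close> lies at distance exactly
      \<open>2 * M\<close> from \<open>p\<close>, too far for two points of
      \<open>ball 0 M\<close>.\<close>
    define z where "z = complex_of_real (2 * M / norm (q - p))"
    have "L z \<in> ball 0 M" "p \<in> ball 0 M"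
      using M assms(4) \<open>U = UNIV\<close> unfolding U_def by blast+
    then have "norm (L z - p) < 2 * M"
      using norm_triangle_ineq4[of "L z" p] by simp
    moreover have "norm (L z - p) = 2 * M"
      using \<open>0 < M\<close> assms(6) by (simp add: L_def z_def norm_vector_scalar_mult norm_divide norm_mult
          del: vector_ssub_ldistrib)
    ultimately show False by simp
  qed
  moreover have U: "0 \<in> U" "1 \<in> U"
    using assms by (auto simp: U_def L_def)
  ultimately obtain h g where h: "\<And>z. z \<in> U \<Longrightarrow> norm (h z) < 1 \<and> g (h z) = z"
    and g: "g holomorphic_on ball 0 1" "\<And>z. norm z < 1 \<Longrightarrow> g z \<in> U"
    using Riemann_mapping_theorem[of U] convex_imp_simply_connected[of U]
    by (metis empty_iff mem_ball_0)
  \<comment> \<open>Since \<open>L 0 = p\<close> and \<open>L 1 = q\<close>, the Riemann parameters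
    are \<open>h 0\<close> and \<open>h 1\<close>. The automorphism taking \<open>h 0\<close> to 0
    takes \<open>h 1\<close> to \<open>c\<close>, \<open>m\<close> is its inverse, and rotation by
    \<open>u\<close> replaces \<open>c\<close> by the real parameter \<open>norm c\<close>.\<close>
  define c where "c = Moebius_function 0 (h 0) (h 1)"
  define m where "m = Moebius_function 0 (- h 0)"
  define u where "u = sgn c"
  have m: "m holomorphic_on ball 0 1" "\<And>z. norm z < 1 \<Longrightarrow> norm (m z) < 1"
    unfolding m_def using h[OF U(1)] 
    by (simp_all add: Moebius_function_holomorphic Moebius_function_norm_lt_1)
  have mc: "m 0 = h 0" "m c = h 1"
    using h[OF U(1)] h[OF U(2)] by (simp_all add: m_def c_def Moebius_function_of_zero Moebius_function_compose)
  have c1: "norm c < 1"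
    using h[OF U(1)] h[OF U(2)] by (simp add: c_def Moebius_function_norm_lt_1)
  have "c \<noteq> 0"
    using mc h[OF U(1)] h[OF U(2)] by auto
  then have u: "norm u = 1" "of_real (norm c) * u = c"
    by (simp_all add: u_def norm_sgn) (simp add: sgn_div_norm scaleR_conv_of_real)
  define \<phi> where "\<phi> = (\<lambda>z. L (g (m (z * u))))"
  have Lg: "holomorphic_disc D (\<lambda>z. L (g z))"
    using g unfolding L_def U_def
    by (intro holomorphic_discI) (auto intro!: holomorphic_intros)
  have "holomorphic_disc D (\<lambda>z. L (g (m z)))"
    by (rule holomorphic_disc_reparam[OF Lg m])
  then have "holomorphic_disc D \<phi>"
    unfolding \<phi>_def by (rule holomorphic_disc_reparam) (auto intro!: holomorphic_intros simp: norm_mult u)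
  moreover have "\<phi> 0 = p" "\<phi> (of_real (norm c)) = q"
    using h[OF U(1)] h[OF U(2)] by (simp_all add: \<phi>_def mc u L_def)
  ultimately show thesis
    using that[of "norm c" \<phi>] \<open>c \<noteq> 0\<close> c1 by auto
qed

text \<open>The linear correction moves the centre of the disc from near \<^term>\<open>p\<close> to \<^term>\<open>p\<close>;
  shrinking the disc first leaves the room for it, at the price of an arbitrarily small increase
  of the parameter.\<close>

lemma holomorphic_disc_recentre:
  fixes D :: "(complex ^ 'n) set"
  assumes "open D" "convex D" "p \<in> D" and \<rho>: "0 < \<rho>" "\<rho> < \<rho>'"
  obtains \<delta> where "0 < \<delta>"
    "\<And>\<phi>. \<lbrakk>holomorphic_disc D \<phi>; dist (\<phi> 0) p < \<delta>\<rbrakk> \<Longrightarrow>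
      \<exists>\<psi>. holomorphic_disc D \<psi> \<and> \<psi> 0 = p \<and> \<psi> (of_real \<rho>') = \<phi> (of_real \<rho>)"
proof -
  obtain d where d: "0 < d" "ball p (2 * d) \<subseteq> D"
    using openE[OF assms(1,3)] by (metis field_sum_of_halves half_gt_zero mult_2)
  \<comment> \<open>The shrinking factor: \<open>t * \<rho>' = \<rho>\<close>, so the shrunk disc
    takes at \<open>\<rho>'\<close> the value of \<open>\<phi>\<close> at
    \<open>\<rho>\<close>.\<close>
  define t where "t = \<rho> / \<rho>'"
  have t: "0 < t" "t < 1"
    using \<rho> by (auto simp: t_def)
  define \<eta> where "\<eta> = (1 - t) / (1 + t) * d"
  have \<eta>: "0 < \<eta>"
    using t d by (simp add: \<eta>_def)
  \<comment> \<open>The bound \<open>d\<close> puts \<open>ball (\<phi> 0) d\<close> inside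
    \<open>ball p (2 * d)\<close>; the other bound keeps the correction below the Harnack room
    \<open>\<eta>\<close>, its scalar factor having norm at most
    \<open>1 + 1 / \<rho>'\<close>.\<close>
  define \<delta> where "\<delta> = min d (\<eta> / (1 + 1 / \<rho>'))"
  show thesis
  proof
    show "0 < \<delta>"
      using d \<eta> \<rho> by (simp add: \<delta>_def add_pos_pos)
    fix \<phi> assume \<phi>: "holomorphic_disc D \<phi>" "dist (\<phi> 0) p < \<delta>"
    \<comment> \<open>The factor \<open>1 - z / \<rho>'\<close> is 1 at 0, which moves the centre to
      \<open>p\<close>, and 0 at \<open>\<rho>'\<close>, which leaves that value unchanged.\<close>
    define \<psi> where "\<psi> = (\<lambda>z. \<phi> (of_real t * z) + (1 - z / of_real \<rho>') *s (p - \<phi> 0))"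
    have tz: "norm (of_real t * z) \<le> t" if "norm z < 1" for z :: complex
      using t that by (simp add: norm_mult)
    have "holomorphic_disc D (\<lambda>z. \<phi> (of_real t * z))"
      using \<phi>(1) by (rule holomorphic_disc_reparam)
        (use tz t in \<open>auto intro!: holomorphic_intros intro: le_less_trans\<close>)
    note hol = holomorphic_discD(1)[OF this]
    have "ball (\<phi> 0) d \<subseteq> D"
    proof -
      have "ball (\<phi> 0) d \<subseteq> ball p (2 * d)"
        using \<phi>(2) unfolding \<delta>_def by (intro ball_subset_ball_iff[THEN iffD2]) auto
      then show ?thesis using d by blast
    qed
    note room = holomorphic_disc_ball_subset[OF assms(1,2) \<phi>(1) d(1) this tz t(2), folded \<eta>_def]
    have "holomorphic_disc D \<psi>"
    proof (rule holomorphic_discI)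
      show "(\<lambda>z. \<psi> z $ i) holomorphic_on ball 0 1" for i
        unfolding \<psi>_def using \<rho> by (auto intro!: holomorphic_intros hol)
    next
      fix z :: complex assume z: "norm z < 1"
      have "norm ((1 - z / of_real \<rho>') *s (p - \<phi> 0)) = norm (1 - z / of_real \<rho>') * norm (p - \<phi> 0)"
        by (rule norm_vector_scalar_mult)
      also have "\<dots> \<le> (1 + 1 / \<rho>') * norm (p - \<phi> 0)"
      proof (rule mult_right_mono)
        have "norm (1 - z / of_real \<rho>') \<le> 1 + norm z / \<rho>'"
          using norm_triangle_ineq4[of 1 "z / of_real \<rho>'"] \<rho> by (simp add: norm_divide)
        also have "\<dots> \<le> 1 + 1 / \<rho>'"
          using z \<rho> by (simp add: divide_right_mono)
        finally show "norm (1 - z / of_real \<rho>') \<le> 1 + 1 / \<rho>'" .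
      qed simp
      also have "\<dots> < \<eta>"
      proof -
        have "norm (p - \<phi> 0) < \<eta> / (1 + 1 / \<rho>')"
          using \<phi>(2) by (simp add: \<delta>_def dist_norm norm_minus_commute)
        moreover have "0 < 1 + 1 / \<rho>'"
          using \<rho> by (simp add: add_pos_pos)
        ultimately show ?thesis
          by (simp add: pos_less_divide_eq mult.commute)
      qed
      finally have "norm (\<psi> z - \<phi> (of_real t * z)) < \<eta>"
        by (simp add: \<psi>_def)
      then have "\<psi> z \<in> ball (\<phi> (of_real t * z)) \<eta>"
        by (simp add: dist_norm norm_minus_commute)
      then show "\<psi> z \<in> D"
        using room[OF z] by blast
    qed
    moreover have "\<psi> 0 = p" "\<psi> (of_real \<rho>') = \<phi> (of_real \<rho>)"
      using \<rho> by (simp_all add: \<psi>_def t_def)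
    ultimately show "\<exists>\<psi>. holomorphic_disc D \<psi> \<and> \<psi> 0 = p \<and> \<psi> (of_real \<rho>') = \<phi> (of_real \<rho>)"
      by blast
  qed
qed

section \<open>Fixed points and the extremal parameter\<close>

lemma fixed_point_near:
  fixes D :: "(complex ^ 'n) set" and f :: "complex ^ 'n \<Rightarrow> complex ^ 'n"
  assumes "open D" "bounded D" "convex D" and f: "f holomorphic_map_on D" "f \<in> D \<rightarrow> D"
    and "holomorphic_disc D \<phi>\<^sub>0" and p: "f (\<phi>\<^sub>0 0) = \<phi>\<^sub>0 0" and q: "f (\<phi>\<^sub>0 r) = \<phi>\<^sub>0 r"
    and s: "norm s < 1"
  obtains m where "m \<in> D" "f m = m"
    "m \<in> closure {\<phi> s |\<phi>. holomorphic_disc D \<phi> \<and> \<phi> 0 = \<phi>\<^sub>0 0 \<and> \<phi> r = \<phi>\<^sub>0 r}"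
proof -
  define C where "C = {\<phi> s |\<phi>. holomorphic_disc D \<phi> \<and> \<phi> 0 = \<phi>\<^sub>0 0 \<and> \<phi> r = \<phi>\<^sub>0 r}"
  have CD: "C \<subseteq> D"
    using holomorphic_discD(2)[OF _ s] by (auto simp: C_def)
  obtain d where d: "0 < d" "ball (\<phi>\<^sub>0 0) d \<subseteq> D"
    using openE[OF assms(1) holomorphic_discD(2)[OF assms(6), of 0]] by auto
  define \<eta> where "\<eta> = (1 - norm s) / (1 + norm s) * d"
  have \<eta>: "0 < \<eta>"
    using d s by (simp add: \<eta>_def add_pos_nonneg)
  \<comment> \<open>All discs considered have the same centre, so Harnack gives one radius
    \<open>\<eta>\<close> for every point of \<open>C\<close>; this keeps the closure inside
    \<open>D\<close>.\<close>
  have room: "ball x \<eta> \<subseteq> D" if "x \<in> C" for x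
    using that holomorphic_disc_ball_subset[OF assms(1,3) _ d(1) _ order_refl s] d(2)
    unfolding C_def \<eta>_def by fastforce
  have clD: "closure C \<subseteq> D"
  proof
    fix x assume "x \<in> closure C"
    then obtain y where "y \<in> C" "dist y x < \<eta>"
      using \<eta> closure_approachable by blast
    then show "x \<in> D"
      using room[of y] by auto
  qed
  have contf: "continuous_on D f"
    using f(1) unfolding holomorphic_map_on_def continuous_on_eq_continuous_within
    by (meson has_derivative_continuous)
  have "f \<in> closure C \<rightarrow> closure C"
  proof -
    have "f ` C \<subseteq> C"
    proof clarify
      fix x assume "x \<in> C"
      then obtain \<phi> where "holomorphic_disc D \<phi>" "\<phi> 0 = \<phi>\<^sub>0 0" "\<phi> r = \<phi>\<^sub>0 r" "x = \<phi> s"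
        by (auto simp: C_def)
      \<comment> \<open>Both prescribed values are fixed by \<open>f\<close>, so composing with
        \<open>f\<close> respects the two constraints on \<open>\<phi>\<close>.\<close>
      then show "f x \<in> C"
        unfolding C_def using holomorphic_disc_image[OF assms(1) f, of \<phi>] p q
        by (intro CollectI exI[of _ "\<lambda>z. f (\<phi> z)"]) auto
    qed
    then have "f ` closure C \<subseteq> closure C"
      using continuous_on_subset[OF contf clD] closure_subset
      by (intro image_closure_subset) auto
    then show ?thesis by auto
  qed
  moreover have "compact (closure C)"
    using assms(2) CD bounded_subset compact_closure by blast
  moreover have "convex C"
  proof (rule convexI)
    fix x y and u v :: real assume "x \<in> C" "y \<in> C" and uv: "0 \<le> u" "0 \<le> v" "u + v = 1"
    then obtain \<phi> \<psi> where *: "holomorphic_disc D \<phi>" "\<phi> 0 = \<phi>\<^sub>0 0" "\<phi> r = \<phi>\<^sub>0 r" "x = \<phi> s"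
      "holomorphic_disc D \<psi>" "\<psi> 0 = \<phi>\<^sub>0 0" "\<psi> r = \<phi>\<^sub>0 r" "y = \<psi> s"
      by (auto simp: C_def)
    have "u *\<^sub>R a + v *\<^sub>R a = a" for a :: "complex ^ 'n"
      using uv(3) by (metis scaleR_add_left scaleR_one)
    then show "u *\<^sub>R x + v *\<^sub>R y \<in> C"
      unfolding C_def using * holomorphic_disc_convex_combination[OF assms(3) *(1,5) uv]
      by (intro CollectI exI[of _ "\<lambda>z. u *\<^sub>R \<phi> z + v *\<^sub>R \<psi> z"]) auto
  qed
  moreover have "\<phi>\<^sub>0 s \<in> C"
    using assms(6) by (auto simp: C_def)
  ultimately obtain m where "m \<in> closure C" "f m = m"
    using brouwer[of "closure C" f] continuous_on_subset[OF contf clD] convex_closure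
    by (metis closure_eq_empty empty_iff)
  then show thesis
    using that clD unfolding C_def by blast
qed

lemma fixed_point_not_isolated:
  fixes D :: "(complex ^ 'n) set" and f :: "complex ^ 'n \<Rightarrow> complex ^ 'n"
  assumes D: "open D" "bounded D" "convex D" and f: "f holomorphic_map_on D" "f \<in> D \<rightarrow> D"
    and p: "p \<in> D" "f p = p" and q: "q \<in> D" "f q = q" and "p \<noteq> q" "0 < \<epsilon>"
  shows "\<exists>m\<in>D. f m = m \<and> m \<noteq> p \<and> dist m p < \<epsilon>"
proof (rule ccontr)
  assume isolated: "\<not> ?thesis"
  define R where "R = {r. 0 < r \<and> r < 1 \<and>
    (\<exists>\<phi>. holomorphic_disc D \<phi> \<and> \<phi> 0 = p \<and> \<phi> (of_real r) = q)}"
  \<comment> \<open>This is the Lempert function of \<open>D\<close> at \<open>p\<close> and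
    \<open>q\<close>, measured by the parameter itself.\<close>
  define r\<^sub>0 where "r\<^sub>0 = Inf R"
  have "R \<noteq> {}"
  proof -
    obtain r \<phi> where "0 < r" "r < 1" "holomorphic_disc D \<phi>" "\<phi> 0 = p" "\<phi> (of_real r) = q"
      using holomorphic_disc_through[OF D p(1) q(1) \<open>p \<noteq> q\<close>] .
    then have "r \<in> R"
      by (auto simp: R_def)
    then show ?thesis by blast
  qed
  obtain M where "0 < M" and M: "D \<subseteq> ball 0 M"
    using bounded_subset_ballD[OF D(2)] by blast
  define C where "C = real CARD('n) * (2 * M)"
  have "0 < C"
    using \<open>0 < M\<close> by (simp add: C_def)
  have bdd: "bdd_below R"
    by (rule bdd_belowI[of _ 0]) (auto simp: R_def)
  \<comment> \<open>A disc cannot get from \<open>p\<close> to \<open>q\<close> within a small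
    parameter; hence the infimum is positive.\<close>
  have "dist q p / C \<le> r" if r: "r \<in> R" for r
  proof -
    obtain \<phi> where "0 < r" "r < 1" "holomorphic_disc D \<phi>" "\<phi> 0 = p" "\<phi> (of_real r) = q"
      using r by (auto simp: R_def)
    then have "dist q p \<le> C * r"
      using holomorphic_disc_dist_bound[OF M, of \<phi> "of_real r"] by (simp add: C_def)
    then show ?thesis
      using \<open>0 < C\<close> by (simp add: pos_divide_le_eq mult.commute)
  qed
  then have "dist q p / C \<le> r\<^sub>0"
    unfolding r\<^sub>0_def using \<open>R \<noteq> {}\<close> by (intro cInf_greatest)
  moreover have "0 < dist q p / C"
    using \<open>p \<noteq> q\<close> \<open>0 < C\<close> by simp
  ultimately have r0: "0 < r\<^sub>0"
    by linarith
  have r0_le: "r\<^sub>0 \<le> r" if "r \<in> R" for r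
    unfolding r\<^sub>0_def using that bdd by (rule cInf_lower)
  have r01: "r\<^sub>0 < 1"
    using r0_le \<open>R \<noteq> {}\<close> by (force simp: R_def)
  \<comment> \<open>One bound gives \<open>s < r\<^sub>0\<close>, which makes \<open>\<rho>\<close>
    positive; the other gives \<open>C * s < \<epsilon>\<close>, which keeps all values at
    \<open>s\<close> within \<open>\<epsilon>\<close> of \<open>p\<close>.\<close>
  define s where "s = min (r\<^sub>0 / 2) (\<epsilon> / (2 * C))"
  have s: "0 < s" "s < r\<^sub>0" "C * s < \<epsilon>"
    using r0 \<open>0 < C\<close> \<open>0 < \<epsilon>\<close> by (auto simp: s_def min_def field_simps)
  \<comment> \<open>The left side is the image of \<open>r\<^sub>0\<close> under the automorphism
    taking 0 to \<open>s\<close>. An \<open>r\<close> in \<open>R\<close> below it is pulled back to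
    \<open>\<rho> < r\<^sub>0\<close>.\<close>
  have "(r\<^sub>0 + s) / (1 + r\<^sub>0 * s) > r\<^sub>0"
  proof -
    have "r\<^sub>0 * r\<^sub>0 * s < 1 * s"
      using mult_strict_mono[of r\<^sub>0 1 r\<^sub>0 1] r0 r01 s by (intro mult_strict_right_mono) auto
    then have "r\<^sub>0 * (1 + r\<^sub>0 * s) < r\<^sub>0 + s"
      by (simp add: algebra_simps)
    then show ?thesis
      using r0 s by (simp add: pos_less_divide_eq add_pos_pos)
  qed
  then obtain r where r: "r \<in> R" "r < (r\<^sub>0 + s) / (1 + r\<^sub>0 * s)"
    using cInf_lessD[OF \<open>R \<noteq> {}\<close>] unfolding r\<^sub>0_def by blast
  then have "r\<^sub>0 \<le> r" "r < 1"
    using r0_le by (auto simp: R_def)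
  define \<rho> where "\<rho> = (r - s) / (1 - r * s)"
  have rs: "0 < 1 - r * s"
    using mult_strict_mono[of r 1 s 1] \<open>r < 1\<close> s r01 by simp
  have "0 < \<rho>" "\<rho> < r\<^sub>0"
    using rs r \<open>r\<^sub>0 \<le> r\<close> s r0 by (auto simp: \<rho>_def field_simps add_pos_pos)
  then obtain \<rho>' where \<rho>': "\<rho> < \<rho>'" "\<rho>' < r\<^sub>0"
    using dense by blast
  \<comment> \<open>The gap between \<open>\<rho>\<close> and \<open>\<rho>'\<close> pays for
    recentring. As \<open>\<delta>\<close> does not depend on the disc, the disc can be chosen
    afterwards.\<close>
  obtain \<delta> where "0 < \<delta>" and recentre: "\<And>\<phi>. \<lbrakk>holomorphic_disc D \<phi>; dist (\<phi> 0) p < \<delta>\<rbrakk> \<Longrightarrow>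
      \<exists>\<psi>. holomorphic_disc D \<psi> \<and> \<psi> 0 = p \<and> \<psi> (of_real \<rho>') = \<phi> (of_real \<rho>)"
    by (rule holomorphic_disc_recentre[OF D(1,3) p(1) \<open>0 < \<rho>\<close> \<rho>'(1)]) (rule that; blast)
  obtain \<phi>\<^sub>0 where \<phi>\<^sub>0: "holomorphic_disc D \<phi>\<^sub>0" "\<phi>\<^sub>0 0 = p" "\<phi>\<^sub>0 (of_real r) = q"
    using r(1) by (auto simp: R_def)
  let ?S = "{\<phi> (of_real s) |\<phi>. holomorphic_disc D \<phi> \<and> \<phi> 0 = p \<and> \<phi> (of_real r) = q}"
  obtain m where m: "m \<in> D" "f m = m" "m \<in> closure ?S"
    using fixed_point_near[OF D f \<phi>\<^sub>0(1), of "of_real r" "of_real s"] \<phi>\<^sub>0 p q s r01 by auto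
  have "?S \<subseteq> cball p (C * s)"
    using holomorphic_disc_dist_bound[OF M, of _ "of_real s"] s r01
    by (force simp: C_def dist_commute)
  then have "closure ?S \<subseteq> cball p (C * s)"
    by (simp add: closure_minimal)
  then have "dist m p < \<epsilon>"
    using m(3) s(3) by (auto simp: dist_commute)
  then have "m = p"
    using isolated m by blast
  then obtain \<phi> where \<phi>: "holomorphic_disc D \<phi>" "\<phi> 0 = p" "\<phi> (of_real r) = q"
      "dist (\<phi> (of_real s)) p < \<delta>"
    using m(3) \<open>0 < \<delta>\<close> by (auto simp: closure_approachable)
  have "0 \<le> s" "s < 1" "0 \<le> r"
    using s r0 r01 \<open>r\<^sub>0 \<le> r\<close> by auto
  then obtain g where g: "g holomorphic_on ball 0 1" "\<And>z. norm z < 1 \<Longrightarrow> norm (g z) < 1"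
    "g 0 = of_real s" "g (of_real \<rho>) = of_real r"
    using disc_automorphism[of s thesis] \<open>r < 1\<close> unfolding \<rho>_def by blast
  \<comment> \<open>The disc \<open>\<phi> (g z)\<close> has centre
    \<open>\<phi> (of_real s)\<close>, within \<open>\<delta>\<close> of \<open>p\<close>, and value
    \<open>q\<close> at \<open>\<rho>\<close>.\<close>
  have "\<exists>\<psi>. holomorphic_disc D \<psi> \<and> \<psi> 0 = p \<and> \<psi> (of_real \<rho>') = q"
    using recentre[OF holomorphic_disc_reparam[OF \<phi>(1) g(1,2)]] g \<phi> by simp
  then have "\<rho>' \<in> R"
    using \<open>0 < \<rho>\<close> \<rho>' r01 by (simp add: R_def)
  then show False
    using r0_le \<rho>' by force
qed

theorem proposition1p1:
  fixes D :: "(complex ^ 'n) set" and f :: "complex ^ 'n \<Rightarrow> complex ^ 'n"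
  assumes "open D" and "connected D" and "bounded D" and "convex D"
    and "f holomorphic_map_on D" and "f \<in> D \<rightarrow> D"
    and "discrete (Fix_on D f)" and "Fix_on D f \<noteq> {}"
  shows "\<exists>p. Fix_on D f = {p}"
proof -
  obtain p where p: "p \<in> Fix_on D f"
    using assms(8) by blast
  obtain \<epsilon> where \<epsilon>: "0 < \<epsilon>" "\<forall>y\<in>Fix_on D f. dist p y < \<epsilon> \<longrightarrow> y = p"
    using discreteD[OF assms(7) p] isolated_in_dist_Ex_iff by blast
  have "q = p" if "q \<in> Fix_on D f" for q
    using fixed_point_not_isolated[OF assms(1,3-6), of p q \<epsilon>] p that \<epsilon>
    by (auto simp: Fix_on_def dist_commute)
  then show ?thesis
    using p by blast
qed

end
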